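(* Let $d(m)$ denote the number of positive divisors of a positive integer $m$. Then $$\sum_{2 \leq n \leq N} d(n^2-1) \sim \frac{6}{\pi^2} N \log^2 N$$ as $N \rightarrow \infty$, where the sum runs over integers $n$ with $2 \le n \le N$; that is, the ratio of the two sides tends to $1$ as $N \to \infty$.
   Context: Here $\log^2 N = (\log N)^2$, with $\log$ the natural logarithm. *)

theory Defs
  imports "HOL-Library.Landau_Symbols"
begin

definition num_divisors :: "nat \<Rightarrow> nat" where
  "num_divisors m = card {k. k dvd m}"

end

theory Submission
  imports Defs "HOL-Analysis.Analysis" "HOL-Number_Theory.Number_Theory" "HOL-Real_Asymp.Real_Asymp"
begin

text \<open>
  Let \<open>\<rho>(d)\<close> be the number of square roots of 1 modulo \<open>d\<close>. Pairing each divisor of \<open>n\<^sup>2 - 1\<close> with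
  its codivisor, the sum is twice the number of pairs \<open>d < n \<le> N\<close> with \<open>n\<^sup>2 \<equiv> 1\<close> modulo \<open>d\<close>, which is
  asymptotic to \<open>2 N G(N)\<close> with \<open>G(N) = \<Sum>d\<le>N. \<rho>(d) / d\<close>. Restricting to \<open>d \<le> N / K\<close> gives the lower
  bound without any estimate for \<open>\<Sum>\<rho>(d)\<close>, because \<open>G(N / K)\<close> is asymptotic to \<open>G(N)\<close>.

  For odd \<open>m\<close>, \<open>\<rho>(m)\<close> counts the coprime factorizations \<open>m = a b\<close>. Let \<open>F(n)\<close> be the sum of
  \<open>1 / (a b)\<close> over odd coprime \<open>a, b\<close> with \<open>a b \<le> n\<close>. Without coprimality the sum is
  asymptotic to \<open>ln\<^sup>2 n / 8\<close>, and sorting by the gcd \<open>e\<close> it equals \<open>\<Sum>e odd. F(n / e\<^sup>2) / e\<^sup>2\<close>; as \<open>F\<close> is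
  monotone and \<open>\<Sum>e odd. 1 / e\<^sup>2 = \<pi>\<^sup>2 / 8\<close>, \<open>F(n)\<close> is asymptotic to \<open>ln\<^sup>2 n / \<pi>\<^sup>2\<close>. Finally
  \<open>G(n) = \<Sum>k. \<rho>(2\<^sup>k) / 2\<^sup>k F(n / 2\<^sup>k)\<close> and \<open>\<Sum>k. \<rho>(2\<^sup>k) / 2\<^sup>k = 3\<close>.
\<close>

subsection \<open>Functions asymptotic to a multiple of the squared logarithm\<close>

text \<open>A limit of quotients, so that sums, differences and scalings of such functions reduce to
  limit arithmetic.\<close>

definition ln_sq_coeff :: "(nat \<Rightarrow> real) \<Rightarrow> real \<Rightarrow> bool" where
  "ln_sq_coeff L c \<longleftrightarrow> (\<lambda>n. L n / (ln (real n))\<^sup>2) \<longlonglongrightarrow> c"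

text \<open>Slow variation of the squared logarithm: the factor \<open>(ln (g n) / ln n)^2\<close>
  tends to 1. Rescaling the argument by a fixed factor, up or down, is the intended use.\<close>

lemma ln_sq_coeff_compose:
  assumes "ln_sq_coeff L c" and g: "filterlim g at_top sequentially"
    and r: "(\<lambda>n. ln (real (g n)) / ln (real n)) \<longlonglongrightarrow> 1"
  shows "ln_sq_coeff (\<lambda>n. L (g n)) c"
proof -
  have "(\<lambda>n. L (g n) / (ln (real (g n)))\<^sup>2) \<longlonglongrightarrow> c"
    using filterlim_compose[OF assms(1)[unfolded ln_sq_coeff_def] g] .
  from tendsto_mult[OF this tendsto_power[OF r, of 2]]
  have lim: "(\<lambda>n. L (g n) / (ln (real (g n)))\<^sup>2 * (ln (real (g n)) / ln (real n))\<^sup>2) \<longlonglongrightarrow> c"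
    by simp
  have "\<forall>\<^sub>F n in sequentially. g n \<ge> 2"
    using g by (auto simp: filterlim_at_top)
  then have "\<forall>\<^sub>F n in sequentially.
      L (g n) / (ln (real (g n)))\<^sup>2 * (ln (real (g n)) / ln (real n))\<^sup>2 = L (g n) / (ln (real n))\<^sup>2"
  proof eventually_elim
    case (elim n)
    then have "ln (real (g n)) > 0" by simp
    then show ?case by (simp add: power_divide)
  qed
  from Lim_transform_eventually[OF lim this] show ?thesis
    by (simp add: ln_sq_coeff_def)
qed

lemma ln_sq_coeff_mult_arg:
  assumes "ln_sq_coeff L c" "q > 0"
  shows "ln_sq_coeff (\<lambda>n. L (n * q)) c"
proof (rule ln_sq_coeff_compose[OF assms(1)])
  show "filterlim (\<lambda>n. n * q) at_top sequentially"
    using assms(2) by (intro filterlim_at_top_mono[OF filterlim_ident]) auto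
  have "real q > 0" using assms by simp
  then have "(\<lambda>n. ln (real n * real q) / ln (real n)) \<longlonglongrightarrow> 1"
    by real_asymp
  then show "(\<lambda>n. ln (real (n * q)) / ln (real n)) \<longlonglongrightarrow> 1" by simp
qed

text \<open>Once \<open>n div q\<close> is positive it lies between \<open>n / (2 * q)\<close> and
  \<open>n\<close>, so its logarithm differs from \<open>ln n\<close> by at most the constant
  \<open>ln (2 * q)\<close>.\<close>

lemma ln_sq_coeff_div_arg:
  assumes "ln_sq_coeff L c" "q > 0"
  shows "ln_sq_coeff (\<lambda>n. L (n div q)) c"
proof (rule ln_sq_coeff_compose[OF assms(1)])
  show "filterlim (\<lambda>n. n div q) at_top sequentially"
    unfolding filterlim_at_top
  proof
    fix Z
    show "\<forall>\<^sub>F n in sequentially. Z \<le> n div q"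
      using eventually_ge_at_top[of "Z * q"]
      by eventually_elim (use assms(2) in \<open>simp add: less_eq_div_iff_mult_less_eq\<close>)
  qed
  have q: "real q > 0" using assms by simp
  have lo: "(\<lambda>n. (ln (real n) - ln (2 * real q)) / ln (real n)) \<longlonglongrightarrow> 1"
    using q by real_asymp
  have b: "ln (real n) - ln (2 * real q) \<le> ln (real (n div q)) \<and> ln (real (n div q)) \<le> ln (real n)
      \<and> ln (real n) > 0"
    if n: "n \<ge> q + 2" for n
  proof -
    define m where "m = n div q"
    have m: "m \<ge> 1" using n assms(2) by (simp add: m_def Suc_le_eq div_greater_zero_iff)
    have "n < q * (m + 1)" unfolding m_def
      using assms(2) dividend_less_times_div[of q n] by simp
    also have "\<dots> \<le> q * (m * 2)" using m by simp
    finally have "real n \<le> 2 * real q * real m"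
      by (metis mult.commute mult.left_commute less_imp_le of_nat_le_iff of_nat_mult of_nat_numeral)
    then have "ln (real n) \<le> ln (2 * real q * real m)"
      using n m q by (intro ln_mono) auto
    also have "\<dots> = ln (2 * real q) + ln (real m)" using m q by (subst ln_mult) auto
    finally show ?thesis using m n by (auto simp: m_def intro!: ln_mono)
  qed
  show "(\<lambda>n. ln (real (n div q)) / ln (real n)) \<longlonglongrightarrow> 1"
  proof (rule tendsto_sandwich[OF _ _ lo tendsto_const[of 1]])
    show "\<forall>\<^sub>F n in sequentially. (ln (real n) - ln (2 * real q)) / ln (real n) \<le> ln (real (n div q)) / ln (real n)"
      using eventually_ge_at_top[of "q+2"]
      by eventually_elim (use b in \<open>auto intro!: divide_right_mono\<close>)
    show "\<forall>\<^sub>F n in sequentially. ln (real (n div q)) / ln (real n) \<le> 1"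
      using eventually_ge_at_top[of "q+2"]
      by eventually_elim (use b in auto)
  qed
qed

text \<open>Models the restriction of one variable of a pair sum to odd values: the even values
  contribute \<open>L (n div 2) / 2\<close>, which carries half of the coefficient.\<close>

lemma ln_sq_coeff_minus_half:
  assumes "ln_sq_coeff L c"
  shows "ln_sq_coeff (\<lambda>n. L n - L (n div 2) / 2) (c / 2)"
proof -
  have "(\<lambda>n. L (n div 2) / (ln (real n))\<^sup>2) \<longlonglongrightarrow> c"
    using ln_sq_coeff_div_arg[OF assms, of 2] by (simp add: ln_sq_coeff_def)
  then have "(\<lambda>n. L (n div 2) / (ln (real n))\<^sup>2 / 2) \<longlonglongrightarrow> c / 2"
    by (rule tendsto_divide) auto
  then have "(\<lambda>n. L n / (ln (real n))\<^sup>2 - L (n div 2) / (ln (real n))\<^sup>2 / 2) \<longlonglongrightarrow> c - c / 2"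
    using assms unfolding ln_sq_coeff_def by (intro tendsto_diff)
  then show ?thesis by (simp add: ln_sq_coeff_def diff_divide_distrib mult.commute)
qed

lemma partial_sums_atMost:
  fixes w :: "nat \<Rightarrow> real"
  assumes "w sums W"
  shows "(\<lambda>K. \<Sum>i\<le>K. w i) \<longlonglongrightarrow> W"
  using assms by (simp add: sums_def_le)

text \<open>Monotonicity gives \<open>A n \<le> W * L n\<close>. Conversely, the first
  \<open>K\<close> terms alone have coefficient \<open>c\<close> times a partial sum of
  \<open>w\<close>, and this approaches \<open>c * W\<close> as \<open>K\<close> grows; the other
  terms are nonnegative.\<close>

lemma ln_sq_coeff_weighted_sum:
  assumes L: "ln_sq_coeff L c" and mono: "mono L" and nn: "\<And>n. L n \<ge> 0"
    and q: "\<And>i. q i > 0" and w: "\<And>i. w i \<ge> 0" and W: "w sums W"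
    and A: "\<And>n. A n = (\<Sum>i\<le>n. w i * L (n div q i))"
  shows "ln_sq_coeff A (c * W)"
  unfolding ln_sq_coeff_def
proof (rule order_tendstoI)
  have up: "A n \<le> W * L n" for n
  proof -
    have "A n \<le> (\<Sum>i\<le>n. w i * L n)"
      unfolding A by (intro sum_mono mult_left_mono monoD[OF mono] w) simp
    also have "\<dots> = (\<Sum>i\<le>n. w i) * L n" by (simp add: sum_distrib_right)
    also have "\<dots> \<le> W * L n"
      using W w by (intro mult_right_mono nn) (auto simp: sums_iff intro!: sum_le_suminf)
    finally show ?thesis .
  qed
  fix a assume "c * W < a"
  moreover have "(\<lambda>n. W * (L n / (ln (real n))\<^sup>2)) \<longlonglongrightarrow> W * c"
    using L unfolding ln_sq_coeff_def by (intro tendsto_intros)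
  ultimately have "\<forall>\<^sub>F n in sequentially. W * (L n / (ln (real n))\<^sup>2) < a"
    by (intro order_tendstoD) (auto simp: mult.commute)
  then show "\<forall>\<^sub>F n in sequentially. A n / (ln (real n))\<^sup>2 < a"
  proof eventually_elim
    case (elim n)
    have "A n / (ln (real n))\<^sup>2 \<le> W * L n / (ln (real n))\<^sup>2"
      by (intro divide_right_mono up) auto
    then show ?case using elim by simp
  qed
next
  fix a assume "a < c * W"
  moreover have "(\<lambda>K. c * (\<Sum>i\<le>K. w i)) \<longlonglongrightarrow> c * W"
    by (intro tendsto_intros partial_sums_atMost W)
  ultimately have "\<forall>\<^sub>F K in sequentially. a < c * (\<Sum>i\<le>K. w i)"
    by (intro order_tendstoD)
  then obtain K where K: "a < c * (\<Sum>i\<le>K. w i)"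
    using eventually_happens'[OF sequentially_bot] by blast
  have "(\<lambda>n. \<Sum>i\<le>K. w i * (L (n div q i) / (ln (real n))\<^sup>2)) \<longlonglongrightarrow> (\<Sum>i\<le>K. w i * c)"
    using ln_sq_coeff_div_arg[OF L q] unfolding ln_sq_coeff_def by (intro tendsto_intros)
  then have "\<forall>\<^sub>F n in sequentially. a < (\<Sum>i\<le>K. w i * (L (n div q i) / (ln (real n))\<^sup>2))"
    using K by (intro order_tendstoD) (auto simp: sum_distrib_left mult.commute)
  then show "\<forall>\<^sub>F n in sequentially. a < A n / (ln (real n))\<^sup>2"
    using eventually_ge_at_top[of K]
  proof eventually_elim
    case (elim n)
    have "(\<Sum>i\<le>K. w i * L (n div q i)) \<le> A n"
      unfolding A using elim by (intro sum_mono2) (auto intro!: mult_nonneg_nonneg w nn)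
    then have "(\<Sum>i\<le>K. w i * L (n div q i)) / (ln (real n))\<^sup>2 \<le> A n / (ln (real n))\<^sup>2"
      by (intro divide_right_mono) auto
    with elim show ?case by (simp add: sum_divide_distrib)
  qed
qed

text \<open>A Tauberian converse: since \<open>L\<close> is monotone and \<open>ln\<^sup>2\<close> varies slowly,
  \<open>(\<Sum>i\<le>K. w i) * L n \<le> A (n * Q)\<close> with \<open>Q\<close> a multiple of all \<open>q i\<close>, \<open>i \<le> K\<close>, is
  an upper bound of the right order. This replaces Moebius inversion.\<close>

lemma ln_sq_coeff_weighted_sum_converse:
  assumes A_coeff: "ln_sq_coeff A c" and mono: "mono L" and nn: "\<And>n. L n \<ge> 0"
    and q: "\<And>i. q i > 0" and w: "\<And>i. w i \<ge> 0" and W: "w sums W" and W0: "W > 0"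
    and A: "\<And>n. A n = (\<Sum>i\<le>n. w i * L (n div q i))"
  shows "ln_sq_coeff L (c / W)"
  unfolding ln_sq_coeff_def
proof (rule order_tendstoI)
  have up: "A n / W \<le> L n" for n
  proof -
    have "A n \<le> (\<Sum>i\<le>n. w i * L n)"
      unfolding A by (intro sum_mono mult_left_mono monoD[OF mono] w) simp
    also have "\<dots> = (\<Sum>i\<le>n. w i) * L n" by (simp add: sum_distrib_right)
    also have "\<dots> \<le> W * L n"
      using W w by (intro mult_right_mono nn) (auto simp: sums_iff intro!: sum_le_suminf)
    finally show ?thesis using W0 by (simp add: field_simps)
  qed
  fix a assume "a < c / W"
  moreover have "(\<lambda>n. A n / (ln (real n))\<^sup>2 / W) \<longlonglongrightarrow> c / W"
    using A_coeff W0 unfolding ln_sq_coeff_def by (intro tendsto_intros) auto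
  ultimately have "\<forall>\<^sub>F n in sequentially. a < A n / (ln (real n))\<^sup>2 / W"
    by (intro order_tendstoD)
  then show "\<forall>\<^sub>F n in sequentially. a < L n / (ln (real n))\<^sup>2"
  proof eventually_elim
    case (elim n)
    have "A n / W / (ln (real n))\<^sup>2 \<le> L n / (ln (real n))\<^sup>2"
      by (intro divide_right_mono up) auto
    then show ?case using elim by (simp add: mult.commute)
  qed
next
  fix a assume "c / W < a"
  moreover have "(\<lambda>K. c / (\<Sum>i\<le>K. w i)) \<longlonglongrightarrow> c / W"
    using W0 by (intro tendsto_intros partial_sums_atMost W) auto
  ultimately have "\<forall>\<^sub>F K in sequentially. c / (\<Sum>i\<le>K. w i) < a"
    by (intro order_tendstoD)
  moreover have "\<forall>\<^sub>F K in sequentially. 0 < (\<Sum>i\<le>K. w i)"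
    using partial_sums_atMost[OF W] W0 by (intro order_tendstoD)
  ultimately have "\<forall>\<^sub>F K in sequentially. c / (\<Sum>i\<le>K. w i) < a \<and> 0 < (\<Sum>i\<le>K. w i)"
    by eventually_elim simp
  then obtain K where K: "c / (\<Sum>i\<le>K. w i) < a" and K0: "0 < (\<Sum>i\<le>K. w i)"
    using eventually_happens'[OF sequentially_bot] by blast
  define Q where "Q = (\<Prod>i\<le>K. q i)"
  have Q: "Q > 0" using q by (auto simp: Q_def intro!: prod_pos)
  have qQ: "q i \<le> Q" if "i \<le> K" for i
    using that Q unfolding Q_def by (intro dvd_imp_le dvd_prodI) auto
  have "(\<lambda>n. A (n * Q) / (ln (real n))\<^sup>2 / (\<Sum>i\<le>K. w i)) \<longlonglongrightarrow> c / (\<Sum>i\<le>K. w i)"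
    using ln_sq_coeff_mult_arg[OF A_coeff Q] K0 unfolding ln_sq_coeff_def by (intro tendsto_intros) auto
  then have "\<forall>\<^sub>F n in sequentially. A (n * Q) / (ln (real n))\<^sup>2 / (\<Sum>i\<le>K. w i) < a"
    using K by (intro order_tendstoD)
  then show "\<forall>\<^sub>F n in sequentially. L n / (ln (real n))\<^sup>2 < a"
    using eventually_ge_at_top[of K]
  proof eventually_elim
    case (elim n)
    have "(\<Sum>i\<le>K. w i) * L n = (\<Sum>i\<le>K. w i * L n)" by (simp add: sum_distrib_right)
    also have "\<dots> \<le> (\<Sum>i\<le>K. w i * L (n * Q div q i))"
    proof (intro sum_mono mult_left_mono monoD[OF mono] w)
      fix i assume "i \<in> {..K}"
      then have "n * q i \<le> n * Q" using qQ by simp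
      then show "n \<le> n * Q div q i"
        using q by (simp add: less_eq_div_iff_mult_less_eq)
    qed
    also have "\<dots> \<le> A (n * Q)"
    proof -
      have "n \<le> n * Q" using Q by simp
      then have "K \<le> n * Q" using elim by linarith
      then show ?thesis
        unfolding A by (intro sum_mono2) (auto intro!: mult_nonneg_nonneg w nn)
    qed
    finally have "L n \<le> A (n * Q) / (\<Sum>i\<le>K. w i)" using K0 by (simp add: field_simps)
    then have "L n / (ln (real n))\<^sup>2 \<le> A (n * Q) / (\<Sum>i\<le>K. w i) / (ln (real n))\<^sup>2"
      by (intro divide_right_mono) auto
    then show ?case using elim by (simp add: mult.commute)
  qed
qed

section \<open>Logarithmic and harmonic sums\<close>

text \<open>Discrete form of the integral of \<open>ln x / x\<close>: passing from \<open>n\<close>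
  to \<open>n + 1\<close> changes the difference by at most \<open>1 / (n + 1)\<close>, and these
  errors add up to \<open>harm n\<close>.\<close>

lemma sum_ln_over_nat_bound:
  "\<bar>(\<Sum>a=1..n. ln (real a) / real a) - (ln (real n))\<^sup>2 / 2\<bar> \<le> harm n"
proof (induction n)
  case 0
  then show ?case by (simp add: harm_def)
next
  case (Suc n)
  show ?case
  proof (cases "n = 0")
    case True
    then show ?thesis by (simp add: harm_def)
  next
    case False
    define x u v where "x = real n" and "u = ln (real (Suc n))" and "v = ln (real n)"
    have x: "x \<ge> 1" using False by (simp add: x_def)
    have v0: "0 \<le> v" and vu: "v \<le> u" using False by (auto simp: u_def v_def)
    have u1: "u \<le> x" unfolding u_def x_def using ln_le_minus_one[of "real (Suc n)"] by simp
    have d1: "u - v \<le> 1 / x"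
    proof -
      have "u - v = ln (1 + 1 / x)"
      proof -
        have "1 + 1 / x = real (Suc n) / x" using False by (simp add: x_def field_simps)
        then show ?thesis using False by (simp add: u_def v_def x_def ln_div)
      qed
      also have "\<dots> \<le> 1 / x" using x by (intro ln_add_one_self_le_self) auto
      finally show ?thesis .
    qed
    have d2: "u - v \<ge> 1 / (x + 1)"
    proof -
      have "v - u = ln (x / (x + 1))"
        using False by (simp add: u_def v_def x_def ln_div add.commute)
      also have "\<dots> \<le> x / (x + 1) - 1" using x by (intro ln_le_minus_one) auto
      also have "\<dots> = - (1 / (x + 1))" using x by (simp add: field_simps)
      finally show ?thesis by simp
    qed
    \<comment> \<open>The factor \<open>(u + v) / 2\<close> lies between \<open>v\<close> and
      \<open>u\<close>, so by \<open>d1\<close> and \<open>d2\<close> the increment lies between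
      \<open>v / (x + 1)\<close> and \<open>u / x\<close>. Both ends are within
      \<open>1 / (x + 1)\<close> of \<open>u / (x + 1)\<close>, because \<open>u - v \<le> 1\<close>
      and \<open>u \<le> x\<close>.\<close>
    have "(u\<^sup>2 - v\<^sup>2) / 2 = (u - v) * ((u + v) / 2)" by (simp add: power2_eq_square algebra_simps)
    moreover have "(u - v) * ((u + v) / 2) \<le> 1 / x * u"
      using d1 v0 vu x by (intro mult_mono) auto
    moreover have "(u - v) * ((u + v) / 2) \<ge> 1 / (x + 1) * v"
      using d2 v0 vu x by (intro mult_mono) auto
    moreover have "1 / x * u - u / (x + 1) \<le> 1 / (x + 1)"
    proof -
      have "1 / x * u - u / (x + 1) = u / x * (1 / (x + 1))" using x by (simp add: field_simps)
      also have "\<dots> \<le> 1 * (1 / (x + 1))" using x u1 by (intro mult_right_mono) auto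
      finally show ?thesis by simp
    qed
    moreover have "u / (x + 1) - 1 / (x + 1) * v \<le> 1 / (x + 1)"
    proof -
      have "1 / x \<le> 1" using x by simp
      with d1 have "u - v \<le> 1" by linarith
      then have "(u - v) / (x + 1) \<le> 1 / (x + 1)" using x by (intro divide_right_mono) auto
      then show ?thesis by (simp add: diff_divide_distrib)
    qed
    ultimately have "\<bar>u / (x + 1) - (u\<^sup>2 - v\<^sup>2) / 2\<bar> \<le> 1 / (x + 1)" by linarith
    moreover have "(\<Sum>a=1..Suc n. ln (real a) / real a) = (\<Sum>a=1..n. ln (real a) / real a) + u / (x + 1)"
      by (simp add: u_def x_def add.commute)
    moreover have "harm (Suc n) = harm n + 1 / (x + 1)"
      by (simp add: harm_Suc x_def inverse_eq_divide add.commute)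
    ultimately show ?thesis using Suc.IH unfolding u_def[symmetric] v_def[symmetric]
      by (simp add: diff_divide_distrib)
  qed
qed

lemma harm_le_one_plus_ln:
  assumes "n > 0"
  shows "harm n \<le> 1 + ln (real n)"
proof -
  have "harm n - ln (real n) \<le> harm 1 - ln (real 1)"
    using euler_mascheroni_sequence_decreasing[of 1 n] assms by simp
  then show ?thesis by (simp add: harm_def)
qed

text \<open>Up to an error of at most 1, \<open>harm (n div a)\<close> is
  \<open>ln n - ln a\<close>. Weighted by \<open>1 / a\<close>, the first logarithm sums to about
  \<open>ln^2 n\<close> and the second to about half of that.\<close>

lemma ln_sq_coeff_sum_harm:
  "ln_sq_coeff (\<lambda>n. \<Sum>a=1..n. harm (n div a) / real a) (1 / 2)"
proof -
  define T :: "nat \<Rightarrow> real" where "T n = (\<Sum>a=1..n. harm (n div a) / real a)" for n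
  define X where "X n = (\<Sum>a=1..n. (ln (real n) - ln (real a)) / real a)" for n
  have harm_sum: "harm n = (\<Sum>a=1..n. 1 / real a)" for n
    by (simp add: harm_def inverse_eq_divide)
  have T1: "X n \<le> T n" for n
    unfolding X_def T_def
  proof (intro sum_mono divide_right_mono)
    fix a assume a: "a \<in> {1..n}"
    then have "n < a * (n div a + 1)" using dividend_less_times_div[of a n] by simp
    then have "real n < real a * (real (n div a) + 1)"
      by (metis of_nat_1 of_nat_add of_nat_less_iff of_nat_mult)
    then have "real n / real a \<le> real (n div a) + 1" using a by (simp add: field_simps)
    then have "ln (real n / real a) \<le> ln (real (n div a) + 1)"
      using a by (intro ln_mono) auto
    also have "\<dots> \<le> harm (n div a)" by (rule ln_le_harm)
    finally show "ln (real n) - ln (real a) \<le> harm (n div a)" using a by (simp add: ln_div)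
  qed auto
  \<comment> \<open>An error of at most 1 in each harmonic number costs at most \<open>1 / a\<close>
    after weighting, hence \<open>harm n\<close> in total.\<close>
  have T2: "T n \<le> X n + harm n" for n
    unfolding X_def T_def harm_sum[of n] sum.distrib[symmetric]
  proof (rule sum_mono)
    fix a assume a: "a \<in> {1..n}"
    then have p: "n div a > 0" by (simp add: div_greater_zero_iff)
    then have "harm (n div a) \<le> 1 + ln (real (n div a))" by (rule harm_le_one_plus_ln)
    also have "real (n div a) \<le> real n / real a" by (rule of_nat_div_le_of_nat)
    then have "ln (real (n div a)) \<le> ln (real n / real a)" using p by (intro ln_mono) auto
    also have "\<dots> = ln (real n) - ln (real a)" using a by (simp add: ln_div)
    finally have "harm (n div a) \<le> ln (real n) - ln (real a) + 1" by simp
    then show "harm (n div a) / real a \<le> (ln (real n) - ln (real a)) / real a + 1 / real a"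
      by (simp add: add_divide_distrib[symmetric] divide_right_mono)
  qed
  have Xeq: "X n = ln (real n) * harm n - (\<Sum>a=1..n. ln (real a) / real a)" for n
    by (simp add: X_def harm_sum diff_divide_distrib sum_subtractf sum_distrib_left)
  define l where "l n = ln (real n)" for n
  \<comment> \<open>Each error \<open>1 + l n\<close> bounds one \<open>harm n\<close>: one comes
    from \<open>sum_ln_over_nat_bound\<close>, and the upper estimate has a second one from
    \<open>T2\<close>.\<close>
  have bnd: "l n * l n - (l n)\<^sup>2 / 2 - (1 + l n) \<le> T n
      \<and> T n \<le> l n * (1 + l n) - (l n)\<^sup>2 / 2 + 2 * (1 + l n)" if n: "n \<ge> 2" for n
  proof -
    have h: "l n \<le> harm n" "harm n \<le> 1 + l n" "l n \<ge> 0"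
      using n order_trans[OF ln_mono[of "real n" "real n + 1"] ln_le_harm[of n]] harm_le_one_plus_ln[of n]
      by (auto simp: l_def)
    have "l n * l n \<le> l n * harm n" "l n * harm n \<le> l n * (1 + l n)"
      using h by (auto intro!: mult_left_mono)
    then show ?thesis using T1[of n] T2[of n] h sum_ln_over_nat_bound[of n]
      unfolding Xeq l_def[symmetric] by (simp add: abs_le_iff distrib_left)
  qed
  have l: "filterlim l at_top sequentially"
    unfolding l_def by (rule filterlim_compose[OF ln_at_top filterlim_real_sequentially])
  have lo: "((\<lambda>x::real. (x * x - x\<^sup>2 / 2 - (1 + x)) / x\<^sup>2) \<longlongrightarrow> 1 / 2) at_top"
    by real_asymp
  have hi: "((\<lambda>x::real. (x * (1 + x) - x\<^sup>2 / 2 + 2 * (1 + x)) / x\<^sup>2) \<longlongrightarrow> 1 / 2) at_top"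
    by real_asymp
  have "(\<lambda>n. T n / (l n)\<^sup>2) \<longlonglongrightarrow> 1 / 2"
  proof (rule tendsto_sandwich[OF _ _ filterlim_compose[OF lo l] filterlim_compose[OF hi l]])
    show "\<forall>\<^sub>F n in sequentially. (l n * l n - (l n)\<^sup>2 / 2 - (1 + l n)) / (l n)\<^sup>2 \<le> T n / (l n)\<^sup>2"
      using eventually_ge_at_top[of 2]
      by eventually_elim (use bnd in \<open>auto intro!: divide_right_mono\<close>)
    show "\<forall>\<^sub>F n in sequentially. T n / (l n)\<^sup>2 \<le> (l n * (1 + l n) - (l n)\<^sup>2 / 2 + 2 * (1 + l n)) / (l n)\<^sup>2"
      using eventually_ge_at_top[of 2]
      by eventually_elim (use bnd in \<open>auto intro!: divide_right_mono\<close>)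
  qed
  then show ?thesis by (simp add: ln_sq_coeff_def T_def l_def)
qed

subsection \<open>Sums over pairs under a hyperbola\<close>

text \<open>The predicate is a parameter so that parity, divisibility and coprimality conditions can
  be imposed one after the other.\<close>

definition pair_sum :: "(nat \<Rightarrow> nat \<Rightarrow> bool) \<Rightarrow> nat \<Rightarrow> real" where
  "pair_sum P n = (\<Sum>(a, b) | 0 < a \<and> 0 < b \<and> a * b \<le> n \<and> P a b. 1 / (real a * real b))"

lemma le_if_mult_le_nat:
  fixes a b n :: nat
  assumes "a * b \<le> n" "0 < b"
  shows "a \<le> n"
proof -
  have "a * 1 \<le> a * b" using assms(2) by (intro mult_le_mono) auto
  then show ?thesis using assms(1) by linarith
qed

lemma finite_hyperbola_pairs [simp]: "finite {(a, b). 0 < a \<and> 0 < b \<and> a * b \<le> (n::nat) \<and> P a b}"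
proof (rule finite_subset)
  show "{(a, b). 0 < a \<and> 0 < b \<and> a * b \<le> n \<and> P a b} \<subseteq> {..n} \<times> {..n}"
    using le_if_mult_le_nat by (auto, metis mult.commute)
qed simp

lemma pair_sum_nonneg: "pair_sum P n \<ge> 0"
  unfolding pair_sum_def by (intro sum_nonneg) auto

lemma mono_pair_sum: "mono (pair_sum P)"
  unfolding pair_sum_def by (intro monoI sum_mono2) auto

text \<open>For fixed \<open>a\<close> the hyperbola condition reads \<open>b \<le> n div a\<close>,
  so the inner sum is harmonic.\<close>

lemma pair_sum_True: "pair_sum (\<lambda>a b. True) n = (\<Sum>a=1..n. harm (n div a) / real a)"
proof -
  have "{(a, b). 0 < a \<and> 0 < b \<and> a * b \<le> n \<and> True} = (SIGMA a:{1..n}. {1..n div a})"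
    by (auto simp: less_eq_div_iff_mult_less_eq mult.commute dest: le_if_mult_le_nat)
  then have "pair_sum (\<lambda>a b. True) n = (\<Sum>a=1..n. \<Sum>b=1..n div a. 1 / (real a * real b))"
    by (simp add: pair_sum_def sum.Sigma)
  also have "\<dots> = (\<Sum>a=1..n. harm (n div a) / real a)"
    by (simp add: harm_def sum_divide_distrib field_simps)
  finally show ?thesis .
qed

text \<open>Substituting \<open>(s * a, t * b)\<close> for the pair rescales the hyperbola. This
  serves both to remove even values and to divide out a common gcd.\<close>

lemma pair_sum_dvd:
  assumes s: "s > 0" and t: "t > 0"
  shows "pair_sum (\<lambda>a b. s dvd a \<and> t dvd b \<and> P (a div s) (b div t)) n
    = pair_sum P (n div (s * t)) / (real s * real t)"
proof -
  have "pair_sum (\<lambda>a b. s dvd a \<and> t dvd b \<and> P (a div s) (b div t)) n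
    = (\<Sum>(a, b) | 0 < a \<and> 0 < b \<and> a * b \<le> n div (s * t) \<and> P a b. 1 / (real (s * a) * real (t * b)))"
    unfolding pair_sum_def
  proof (rule sum.reindex_bij_witness[where j = "\<lambda>(a, b). (a div s, b div t)" and i = "\<lambda>(a, b). (s * a, t * b)"],
      goal_cases)
    case (2 p)
    then obtain a b where "p = (s * a, t * b)" "0 < s * a" "0 < t * b" "(s * a) * (t * b) \<le> n" "P a b"
      using s t by (auto elim!: dvdE)
    then show ?case using s t by (simp add: less_eq_div_iff_mult_less_eq mult_ac)
  next
    case (4 p)
    then show ?case using s t by (auto simp: less_eq_div_iff_mult_less_eq mult_ac)
  next
    case (5 p)
    then show ?case using s t by (auto elim!: dvdE)
  qed (use s t in auto)
  also have "\<dots> = pair_sum P (n div (s * t)) / (real s * real t)"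
    by (simp add: pair_sum_def sum_divide_distrib case_prod_unfold mult_ac)
  finally show ?thesis .
qed

lemma pair_sum_split:
  "pair_sum P n = pair_sum (\<lambda>a b. P a b \<and> Q a b) n + pair_sum (\<lambda>a b. P a b \<and> \<not> Q a b) n"
  unfolding pair_sum_def
  by (subst sum.union_disjoint[symmetric]) (auto intro!: sum.cong)

lemma ln_sq_coeff_pair_sum_True: "ln_sq_coeff (pair_sum (\<lambda>a b. True)) (1 / 2)"
  using ln_sq_coeff_sum_harm by (simp add: pair_sum_True[abs_def])

lemma ln_sq_coeff_pair_sum_odd: "ln_sq_coeff (pair_sum (\<lambda>a b. odd a)) (1 / 4)"
proof -
  have eq: "pair_sum (\<lambda>a b. odd a) n = pair_sum (\<lambda>a b. True) n - pair_sum (\<lambda>a b. True) (n div 2) / 2" for n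
    using pair_sum_split[of "\<lambda>a b. True" n "\<lambda>a b. odd a"] pair_sum_dvd[of 2 1 "\<lambda>a b. True" n] by simp
  then show ?thesis
    using ln_sq_coeff_minus_half[OF ln_sq_coeff_pair_sum_True] by (simp add: eq[symmetric])
qed

lemma ln_sq_coeff_pair_sum_odd_odd: "ln_sq_coeff (pair_sum (\<lambda>a b. odd a \<and> odd b)) (1 / 8)"
proof -
  have eq: "pair_sum (\<lambda>a b. odd a \<and> odd b) n
      = pair_sum (\<lambda>a b. odd a) n - pair_sum (\<lambda>a b. odd a) (n div 2) / 2" for n
    using pair_sum_split[of "\<lambda>a b. odd a" n "\<lambda>a b. odd b"] pair_sum_dvd[of 1 2 "\<lambda>a b. odd a" n]
    by (simp add: conj_commute)
  then show ?thesis
    using ln_sq_coeff_minus_half[OF ln_sq_coeff_pair_sum_odd] by (simp add: eq[symmetric])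
qed

section \<open>Odd coprime pairs\<close>

abbreviation coprime_pair_sum :: "nat \<Rightarrow> real" where
  "coprime_pair_sum \<equiv> pair_sum (\<lambda>a b. odd a \<and> odd b \<and> coprime a b)"

text \<open>Pairs are sorted by their gcd, written \<open>Suc i\<close> so that the index starts at
  0 as in the weighted sum lemmas. Dividing both entries by the gcd leaves an odd coprime pair and
  divides the product by \<open>(Suc i)^2\<close>. Only even \<open>i\<close> occur, as the gcd of
  odd numbers is odd.\<close>

lemma pair_sum_odd_odd_eq:
  "pair_sum (\<lambda>a b. odd a \<and> odd b) n =
    (\<Sum>i\<le>n. (if even i then 1 / (real (Suc i))\<^sup>2 else 0) * coprime_pair_sum (n div (Suc i)\<^sup>2))"
proof -
  let ?S = "{(a, b). 0 < a \<and> 0 < b \<and> a * b \<le> n \<and> odd a \<and> odd b}"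
  have gcd_eq: "gcd a b = Suc i \<longleftrightarrow> Suc i dvd a \<and> Suc i dvd b \<and> coprime (a div Suc i) (b div Suc i)"
    if "a > 0" for a b i
  proof
    assume "gcd a b = Suc i"
    then show "Suc i dvd a \<and> Suc i dvd b \<and> coprime (a div Suc i) (b div Suc i)"
      using that by (metis div_gcd_coprime gcd_dvd1 gcd_dvd2 gcd_pos_nat less_numeral_extra(3))
  next
    assume "Suc i dvd a \<and> Suc i dvd b \<and> coprime (a div Suc i) (b div Suc i)"
    then obtain a' b' where "a = Suc i * a'" "b = Suc i * b'" "coprime (a div Suc i) (b div Suc i)"
      by (auto elim!: dvdE)
    then have "coprime a' b'" by (metis nonzero_mult_div_cancel_left nat.simps(3))
    then have "gcd (Suc i * a') (Suc i * b') = Suc i"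
      by (metis coprime_imp_gcd_eq_1 gcd_mult_distrib_nat mult.right_neutral)
    then show "gcd a b = Suc i" using \<open>a = _\<close> \<open>b = _\<close> by simp
  qed
  have "pair_sum (\<lambda>a b. odd a \<and> odd b) n
      = (\<Sum>i\<le>n. \<Sum>p | p \<in> ?S \<and> (case p of (a, b) \<Rightarrow> gcd a b - 1) = i. case p of (a, b) \<Rightarrow> 1 / (real a * real b))"
    unfolding pair_sum_def
  proof (rule sum.group[symmetric])
    show "(\<lambda>(a, b). gcd a b - 1) ` ?S \<subseteq> {..n}"
    proof (rule image_subsetI)
      fix p assume "p \<in> ?S"
      then obtain a b where p: "p = (a, b)" "0 < a" "0 < b" "a * b \<le> n" by auto
      then have "gcd a b \<le> a" "a \<le> n" by (auto intro!: gcd_le1_nat intro: le_if_mult_le_nat)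
      then have "gcd a b \<le> n" by linarith
      then show "(case p of (a, b) \<Rightarrow> gcd a b - 1) \<in> {..n}" using p by simp
    qed
  qed auto
  also have "\<dots> = (\<Sum>i\<le>n. pair_sum (\<lambda>a b. odd a \<and> odd b \<and> gcd a b = Suc i) n)"
    unfolding pair_sum_def
  proof (intro sum.cong refl)
    fix i
    show "{p. p \<in> ?S \<and> (case p of (a, b) \<Rightarrow> gcd a b - 1) = i}
      = {(a, b). 0 < a \<and> 0 < b \<and> a * b \<le> n \<and> odd a \<and> odd b \<and> gcd a b = Suc i}"
      using gcd_pos_nat by (auto simp: Suc_diff_1)
  qed
  also have "\<dots> = (\<Sum>i\<le>n. (if even i then 1 / (real (Suc i))\<^sup>2 else 0) * coprime_pair_sum (n div (Suc i)\<^sup>2))"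
  proof (intro sum.cong refl)
    fix i
    show "pair_sum (\<lambda>a b. odd a \<and> odd b \<and> gcd a b = Suc i) n
      = (if even i then 1 / (real (Suc i))\<^sup>2 else 0) * coprime_pair_sum (n div (Suc i)\<^sup>2)"
    proof (cases "even i")
      case True
      \<comment> \<open>Dividing by the odd number \<open>Suc i\<close> preserves parity.\<close>
      have odd_iff: "odd a \<longleftrightarrow> odd (a div Suc i)" if "Suc i dvd a" for a
        using that True by (metis dvd_div_mult_self even_Suc even_mult_iff)
      have iff: "odd a \<and> odd b \<and> gcd a b = Suc i \<longleftrightarrow> Suc i dvd a \<and> Suc i dvd b \<and>
          odd (a div Suc i) \<and> odd (b div Suc i) \<and> coprime (a div Suc i) (b div Suc i)"
        if "a > 0" for a b
        using gcd_eq[OF that] odd_iff by blast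
      have "pair_sum (\<lambda>a b. odd a \<and> odd b \<and> gcd a b = Suc i) n =
        pair_sum (\<lambda>a b. Suc i dvd a \<and> Suc i dvd b \<and> odd (a div Suc i) \<and> odd (b div Suc i)
          \<and> coprime (a div Suc i) (b div Suc i)) n"
        unfolding pair_sum_def
        by (intro sum.cong refl) (use iff in blast)
      also have "\<dots> = coprime_pair_sum (n div (Suc i * Suc i)) / (real (Suc i) * real (Suc i))"
        by (rule pair_sum_dvd) auto
      finally show ?thesis using True by (simp add: power2_eq_square)
    next
      case False
      then have "\<not> (odd a \<and> odd b \<and> gcd a b = Suc i)" for a b
        by (metis even_Suc gcd_dvd1 dvd_trans)
      then have "pair_sum (\<lambda>a b. odd a \<and> odd b \<and> gcd a b = Suc i) n = 0"
        unfolding pair_sum_def by (intro sum.neutral) blast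
      then show ?thesis using False by simp
    qed
  qed
  finally show ?thesis .
qed

text \<open>The squares of even numbers contribute a quarter of \<open>pi^2 / 6\<close>; removing
  them leaves \<open>pi^2 / 8\<close>. Because of the shift by \<open>Suc\<close>, they sit at the
  odd indices \<open>2 * i + 1\<close>.\<close>

lemma inverse_odd_squares_sums:
  "(\<lambda>i. if even i then 1 / (real (Suc i))\<^sup>2 else 0) sums (pi\<^sup>2 / 8)"
proof -
  have all: "(\<lambda>i. 1 / (real (Suc i))\<^sup>2) sums (pi\<^sup>2 / 6)"
    using inverse_squares_sums by (simp add: add.commute)
  then have "(\<lambda>i. 1 / (real (Suc i))\<^sup>2 / 4) sums (pi\<^sup>2 / 6 / 4)" by (rule sums_divide)
  moreover have "1 / (real (Suc i))\<^sup>2 / 4 = (\<lambda>j. if odd j then 1 / (real (Suc j))\<^sup>2 else 0) (2 * i + 1)" for i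
    by (simp add: power2_eq_square field_simps)
  ultimately have "(\<lambda>i. (\<lambda>j. if odd j then 1 / (real (Suc j))\<^sup>2 else 0) (2 * i + 1)) sums (pi\<^sup>2 / 6 / 4)"
    by simp
  then have "(\<lambda>j. if odd j then 1 / (real (Suc j))\<^sup>2 else 0) sums (pi\<^sup>2 / 6 / 4)"
    by (subst (asm) sums_mono_reindex) (auto simp: strict_mono_def, metis oddE Suc_eq_plus1 rangeI)
  from sums_diff[OF all this]
  have "(\<lambda>j. 1 / (real (Suc j))\<^sup>2 - (if odd j then 1 / (real (Suc j))\<^sup>2 else 0)) sums (pi\<^sup>2 / 8)"
    by simp
  then show ?thesis by (rule back_subst[of "\<lambda>f. f sums (pi\<^sup>2 / 8)"]) (auto simp: fun_eq_iff)
qed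

text \<open>The gcd decomposition is inverted by the Tauberian converse, with total weight
  \<open>pi^2 / 8\<close>.\<close>

lemma ln_sq_coeff_coprime_pair_sum: "ln_sq_coeff coprime_pair_sum (1 / pi\<^sup>2)"
proof -
  have "ln_sq_coeff coprime_pair_sum ((1 / 8) / (pi\<^sup>2 / 8))"
    by (rule ln_sq_coeff_weighted_sum_converse[OF ln_sq_coeff_pair_sum_odd_odd mono_pair_sum
          pair_sum_nonneg _ _ inverse_odd_squares_sums _ pair_sum_odd_odd_eq]) auto
  then show ?thesis by simp
qed

subsection \<open>Square roots of 1 modulo d\<close>

text \<open>For \<open>d = 1\<close> the residue 0 counts as a root, so that the number of roots is
  1 there, as multiplicativity requires.\<close>

definition sqrt1 :: "nat \<Rightarrow> nat set" where
  "sqrt1 d = {x. x < d \<and> [x\<^sup>2 = 1] (mod d)}"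

abbreviation rho :: "nat \<Rightarrow> nat" where
  "rho d \<equiv> card (sqrt1 d)"

text \<open>The passage to integers makes \<open>x - 1\<close> a true difference even for
  \<open>x = 0\<close>, so that \<open>x^2 - 1\<close> can be factored.\<close>

lemma cong_sq_iff_int_dvd:
  "[x\<^sup>2 = 1] (mod d) \<longleftrightarrow> int d dvd (int x - 1) * (int x + 1)"
proof -
  have "[x\<^sup>2 = 1] (mod d) \<longleftrightarrow> [int (x\<^sup>2) = int 1] (mod (int d))" by (simp only: cong_int_iff)
  also have "\<dots> \<longleftrightarrow> int d dvd (int x)\<^sup>2 - 1" by (simp add: cong_iff_dvd_diff)
  also have "(int x)\<^sup>2 - 1 = (int x - 1) * (int x + 1)" by (simp add: power2_eq_square algebra_simps)
  finally show ?thesis .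
qed

text \<open>By the Chinese remainder theorem, reduction modulo \<open>m\<close> and \<open>n\<close>
  is a bijection from the roots modulo \<open>m * n\<close> to pairs of roots.\<close>

lemma rho_mult_coprime:
  assumes cop: "coprime m n" and m: "m > 0" and n: "n > 0"
  shows "rho (m * n) = rho m * rho n"
proof -
  have "bij_betw (\<lambda>x. (x mod m, x mod n)) (sqrt1 (m * n)) (sqrt1 m \<times> sqrt1 n)"
    unfolding bij_betw_def
  proof
    show "inj_on (\<lambda>x. (x mod m, x mod n)) (sqrt1 (m * n))"
    proof (intro inj_onI, clarify)
      fix x y assume "x \<in> sqrt1 (m * n)" "y \<in> sqrt1 (m * n)" and xy: "x mod m = y mod m" "x mod n = y mod n"
      then have "x < m * n" "y < m * n" by (auto simp: sqrt1_def)
      moreover have "[x = y] (mod (m * n))"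
        using xy cop by (intro coprime_cong_mult_nat) (auto simp: cong_def)
      ultimately show "x = y" by (simp add: cong_less_modulus_unique_nat)
    qed
    show "(\<lambda>x. (x mod m, x mod n)) ` sqrt1 (m * n) = sqrt1 m \<times> sqrt1 n"
    proof
      show "(\<lambda>x. (x mod m, x mod n)) ` sqrt1 (m * n) \<subseteq> sqrt1 m \<times> sqrt1 n"
      proof
        fix p assume "p \<in> (\<lambda>x. (x mod m, x mod n)) ` sqrt1 (m * n)"
        then obtain x where p: "p = (x mod m, x mod n)" and x: "[x\<^sup>2 = 1] (mod (m * n))"
          by (auto simp: sqrt1_def)
        have "[x\<^sup>2 = 1] (mod m)" "[x\<^sup>2 = 1] (mod n)"
          using x cong_modulus_mult_nat[of "x\<^sup>2" 1 m n] cong_modulus_mult_nat[of "x\<^sup>2" 1 n m]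
          by (simp_all add: mult.commute)
        then show "p \<in> sqrt1 m \<times> sqrt1 n"
          using m n p by (simp add: sqrt1_def cong_def power_mod)
      qed
      show "sqrt1 m \<times> sqrt1 n \<subseteq> (\<lambda>x. (x mod m, x mod n)) ` sqrt1 (m * n)"
      proof clarify
        fix y z assume y: "y \<in> sqrt1 m" and z: "z \<in> sqrt1 n"
        obtain x where x: "x < m * n" "[x = y] (mod m)" "[x = z] (mod n)"
          using binary_chinese_remainder_unique_nat[OF cop, of y z] m n by auto
        have "[x\<^sup>2 = 1] (mod m)" "[x\<^sup>2 = 1] (mod n)"
          using cong_pow[OF x(2), of 2] cong_pow[OF x(3), of 2] y z
          by (auto simp: sqrt1_def intro: cong_trans)
        then have "[x\<^sup>2 = 1] (mod (m * n))" using cop by (rule coprime_cong_mult_nat)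
        then have "x \<in> sqrt1 (m * n)" using x by (simp add: sqrt1_def)
        moreover have "(y, z) = (x mod m, x mod n)"
          using x y z by (auto simp: sqrt1_def cong_def)
        ultimately show "(y, z) \<in> (\<lambda>x. (x mod m, x mod n)) ` sqrt1 (m * n)" by (rule rev_image_eqI)
      qed
    qed
  qed
  then have "rho (m * n) = card (sqrt1 m \<times> sqrt1 n)" by (rule bij_betw_same_card)
  then show ?thesis by (simp add: card_cartesian_product)
qed

text \<open>A square root \<open>x\<close> of 1 modulo an odd \<open>m\<close> corresponds to the coprime factorization
  \<open>m = a * b\<close> with \<open>a dvd x - 1\<close> and \<open>b dvd x + 1\<close>.\<close>

lemma rho_odd:
  assumes m: "odd m"
  shows "rho m = card {(a, b). a * b = m \<and> coprime a b}"
proof -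
  let ?F = "{(a, b). a * b = m \<and> coprime a b}"
  define R where "R x p \<longleftrightarrow> (case p of (a, b) \<Rightarrow> int a dvd int x - 1 \<and> int b dvd int x + 1)" for x p
  have m0: "m > 0" using m by (cases m) auto
  \<comment> \<open>A common divisor of \<open>x - 1\<close> and \<open>x + 1\<close> divides their
    difference 2, and a divisor of the odd \<open>m\<close> is odd. All coprimality claims below
    rest on this.\<close>
  have odd_common: "c = 1" if "c dvd m" "int c dvd int x - 1" "int c dvd int x + 1" for c x
  proof -
    have "int c dvd (int x + 1) - (int x - 1)" using that dvd_diff by blast
    then have "int c dvd 2" by simp
    then have "c dvd 2" by presburger
    moreover have "odd c" using that m by (meson dvd_trans)
    ultimately show "c = 1"
      by (metis dvd_refl prime_nat_iff two_is_prime_nat)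
  qed
  define f where "f p = (THE x. x \<in> sqrt1 m \<and> R x p)" for p
  \<comment> \<open>The Chinese remainder theorem gives a unique \<open>x < m\<close> congruent to 1
    modulo \<open>a\<close> and to -1 modulo \<open>b\<close>, the latter residue being written
    \<open>b - 1\<close> in the naturals. It is a root because \<open>a * b\<close> divides
    \<open>(x - 1) * (x + 1)\<close>.\<close>
  have ex1: "\<exists>!x. x \<in> sqrt1 m \<and> R x p" if p: "p \<in> ?F" for p
  proof -
    obtain a b where ab: "p = (a, b)" "a * b = m" "coprime a b" using p by auto
    have a: "a \<noteq> 0" and b: "b \<noteq> 0" using ab m0 by auto
    have ca: "[x = 1] (mod a) \<longleftrightarrow> int a dvd int x - 1" for x
      by (metis cong_iff_dvd_diff cong_int_iff of_nat_1)
    have cb: "[x = b - 1] (mod b) \<longleftrightarrow> int b dvd int x + 1" for x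
    proof -
      have "[x = b - 1] (mod b) \<longleftrightarrow> [int x = int (b - 1)] (mod int b)" by (simp only: cong_int_iff)
      also have "\<dots> \<longleftrightarrow> int b dvd (int x + 1) - int b" using b by (simp add: cong_iff_dvd_diff of_nat_diff algebra_simps)
      also have "\<dots> \<longleftrightarrow> int b dvd int x + 1" by (metis diff_add_cancel dvd_add_left_iff dvd_refl)
      finally show ?thesis .
    qed
    have root: "[x\<^sup>2 = 1] (mod m)" if "int a dvd int x - 1" "int b dvd int x + 1" for x
      unfolding cong_sq_iff_int_dvd ab(2)[symmetric] using that by (simp add: mult_dvd_mono)
    have "\<exists>!x. x < m \<and> [x = 1] (mod a) \<and> [x = b - 1] (mod b)"
      using binary_chinese_remainder_unique_nat[OF ab(3) a b, of 1 "b - 1"] by (simp add: ab(2))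
    then show ?thesis
      unfolding ca cb using root by (auto simp: sqrt1_def R_def ab(1))
  qed
  have f: "f p \<in> sqrt1 m" "R (f p) p" if "p \<in> ?F" for p
    using theI'[OF ex1[OF that]] unfolding f_def by auto
  have "bij_betw f ?F (sqrt1 m)"
    unfolding bij_betw_def
  proof
    show "inj_on f ?F"
    proof (rule inj_onI)
      fix p p' assume p: "p \<in> ?F" "p' \<in> ?F" and eq: "f p = f p'"
      obtain a b a' b' where ab: "p = (a, b)" "a * b = m" "p' = (a', b')" "a' * b' = m"
        using p by auto
      have d: "int a dvd int (f p) - 1" "int b dvd int (f p) + 1"
        "int a' dvd int (f p) - 1" "int b' dvd int (f p) + 1"
        using f(2)[OF p(1)] f(2)[OF p(2)] eq by (auto simp: R_def ab)
      \<comment> \<open>Both factorizations belong to the same root, so \<open>a\<close> divides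
        \<open>x - 1\<close> and \<open>b'\<close> divides \<open>x + 1\<close>. Thus
        \<open>a\<close> is coprime to \<open>b'\<close>, and \<open>a dvd a' * b'\<close> forces
        \<open>a dvd a'\<close>; by symmetry the two factorizations agree.\<close>
      have "coprime a b'"
      proof (rule coprimeI)
        fix c assume "c dvd a" "c dvd b'"
        then show "is_unit c" using odd_common[of c "f p"] d ab
          by (metis dvd_trans dvd_triv_left int_dvd_int_iff nat_dvd_1_iff_1)
      qed
      moreover have "coprime a' b"
      proof (rule coprimeI)
        fix c assume "c dvd a'" "c dvd b"
        then show "is_unit c" using odd_common[of c "f p"] d ab
          by (metis dvd_trans dvd_triv_left int_dvd_int_iff nat_dvd_1_iff_1)
      qed
      moreover have "a dvd a' * b'" "a' dvd a * b"
        using dvd_triv_left[of a b] dvd_triv_left[of a' b'] by (simp_all add: ab)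
      ultimately have "a dvd a'" "a' dvd a" by (simp_all add: coprime_dvd_mult_left_iff)
      then have "a = a'" by (rule dvd_antisym)
      then show "p = p'" using ab m0 by auto
    qed
    show "f ` ?F = sqrt1 m"
    proof
      show "f ` ?F \<subseteq> sqrt1 m" using f by blast
      show "sqrt1 m \<subseteq> f ` ?F"
      proof
        fix x assume x: "x \<in> sqrt1 m"
        then have "int m dvd (int x - 1) * (int x + 1)" using cong_sq_iff_int_dvd[of x m] by (simp add: sqrt1_def)
        then obtain A B where AB: "int m = A * B" "A dvd int x - 1" "B dvd int x + 1"
          using division_decomp by blast
        \<comment> \<open>The integer factors \<open>A\<close> and \<open>B\<close> may both be
          negative; absolute values preserve their product and divisibility.\<close>
        define a b where "a = nat \<bar>A\<bar>" and "b = nat \<bar>B\<bar>"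
        have "int (a * b) = \<bar>A * B\<bar>" by (simp add: a_def b_def abs_mult)
        also have "\<dots> = int m" by (simp flip: AB(1))
        finally have ab: "a * b = m" by (rule of_nat_eq_iff[THEN iffD1])
        have dv: "int a dvd int x - 1" "int b dvd int x + 1" using AB by (auto simp: a_def b_def)
        have "coprime a b"
        proof (rule coprimeI)
          fix c assume "c dvd a" "c dvd b"
          then show "is_unit c" using odd_common[of c x] dv ab
            by (metis dvd_trans dvd_triv_left int_dvd_int_iff nat_dvd_1_iff_1)
        qed
        then have p: "(a, b) \<in> ?F" using ab by simp
        have "f (a, b) = x" using ex1[OF p] f[OF p] x dv by (auto simp: R_def)
        then show "x \<in> f ` ?F" using p by blast
      qed
    qed
  qed
  then show ?thesis by (simp add: bij_betw_same_card)
qed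

text \<open>A root is odd, say \<open>2 * y + 1\<close>, and the condition becomes
  \<open>2 ^ (k - 1) dvd y * (y + 1)\<close>. One of the consecutive factors is odd, so the power
  divides the other one. Hence \<open>2 ^ k\<close> divides \<open>x - 1\<close> or
  \<open>x + 1\<close>, which leaves four candidates below \<open>2 ^ Suc k\<close>.\<close>

lemma sqrt1_two_power:
  assumes "k \<ge> 2"
  shows "sqrt1 (2 ^ Suc k) = {1, 2 ^ k - 1, 2 ^ k + 1, 2 ^ Suc k - 1}"
proof -
  define M :: int where "M = 2 ^ k"
  have M: "M \<ge> 4" using assms power_increasing[of 2 k "2::int"] by (simp add: M_def)
  have Mn: "int (2 ^ k) = M" by (simp add: M_def)
  have "M = 4 * 2 ^ (k - 2)" using assms unfolding M_def
    by (metis le_add_diff_inverse power_add power2_eq_square mult_2_right numeral_Bit0)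
  then obtain r where r: "M = 4 * r" by blast
  have key: "2 * M dvd (X - 1) * (X + 1) \<longleftrightarrow> X \<in> {1, M - 1, M + 1, 2 * M - 1}"
    if X: "0 \<le> X" "X < 2 * M" for X
  proof
    assume d: "2 * M dvd (X - 1) * (X + 1)"
    have "odd X"
    proof
      assume "even X"
      then have "odd ((X - 1) * (X + 1))" by simp
      moreover have "2 dvd 2 * M" by simp
      ultimately show False using d dvd_trans by blast
    qed
    then obtain y where y: "X = 2 * y + 1" by (auto elim: oddE)
    have "4 * (2 * r) dvd 4 * (y * (y + 1))" using d by (simp add: y r algebra_simps)
    then have dy: "2 ^ (k - 1) dvd y * (y + 1)"
    proof -
      assume "4 * (2 * r) dvd 4 * (y * (y + 1))"
      moreover have "2 * r = 2 ^ (k - 1)"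
        using r assms unfolding M_def by (cases k) auto
      ultimately show ?thesis by simp
    qed
    have "2 ^ (k - 1) dvd y \<or> 2 ^ (k - 1) dvd y + 1"
    proof (cases "even y")
      case True
      then have "coprime (2 ^ (k - 1)) (y + 1)" by simp
      then show ?thesis using dy by (simp add: coprime_dvd_mult_left_iff)
    next
      case False
      then have "coprime (2 ^ (k - 1)) y" by simp
      then show ?thesis using dy by (simp add: coprime_dvd_mult_right_iff)
    qed
    moreover have "2 * 2 ^ (k - 1) = M" using assms unfolding M_def by (cases k) auto
    ultimately have "M dvd 2 * y \<or> M dvd 2 * (y + 1)"
      by (metis mult_dvd_mono dvd_refl)
    moreover have "X - 1 = 2 * y" "X + 1 = 2 * (y + 1)" by (simp_all add: y)
    ultimately have "M dvd X - 1 \<or> M dvd X + 1" by metis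
    then show "X \<in> {1, M - 1, M + 1, 2 * M - 1}"
    proof
      assume "M dvd X - 1"
      then obtain t where t: "X - 1 = M * t" by blast
      \<comment> \<open>Since \<open>-1 \<le> X - 1 < 2 * M - 1\<close> and
        \<open>M \<ge> 4\<close>, the quotient \<open>t\<close> can only be 0 or 1.\<close>
      have "t > (-1)"
      proof (rule ccontr)
        assume "\<not> t > (-1)"
        then have "M * t \<le> M * (-1)" using M by (intro mult_left_mono) auto
        then show False using X M t by linarith
      qed
      moreover have "t < 2"
      proof (rule ccontr)
        assume "\<not> t < 2"
        then have "M * 2 \<le> M * t" using M by (intro mult_left_mono) auto
        then show False using X M t by linarith
      qed
      ultimately have "t = 0 \<or> t = 1" by linarith
      then show ?thesis using t by auto
    next
      assume "M dvd X + 1"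
      then obtain t where t: "X + 1 = M * t" by blast
      have "t > 0"
      proof (rule ccontr)
        assume "\<not> t > 0"
        then have "M * t \<le> M * 0" using M by (intro mult_left_mono) auto
        then show False using X M t by linarith
      qed
      moreover have "t < 3"
      proof (rule ccontr)
        assume "\<not> t < 3"
        then have "M * 3 \<le> M * t" using M by (intro mult_left_mono) auto
        then show False using X M t by linarith
      qed
      ultimately have "t = 1 \<or> t = 2" by linarith
      then show ?thesis using t by auto
    qed
  next
    \<comment> \<open>For the two middle roots \<open>X^2 - 1\<close> equals
      \<open>M * (M - 2)\<close> or \<open>M * (M + 2)\<close>; as 4 divides \<open>M\<close>, both
      are multiples of \<open>2 * M\<close>.\<close>
    assume "X \<in> {1, M - 1, M + 1, 2 * M - 1}"
    then consider "X = 1" | "X = M - 1" | "X = M + 1" | "X = 2 * M - 1" by auto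
    then show "2 * M dvd (X - 1) * (X + 1)"
    proof cases
      case 2
      have "(X - 1) * (X + 1) = 2 * M * (2 * r - 1)" by (simp add: 2 r algebra_simps)
      then show ?thesis by simp
    next
      case 3
      have "(X - 1) * (X + 1) = 2 * M * (2 * r + 1)" by (simp add: 3 r algebra_simps)
      then show ?thesis by simp
    qed auto
  qed
  have "x \<in> sqrt1 (2 ^ Suc k) \<longleftrightarrow> x \<in> {1, 2 ^ k - 1, 2 ^ k + 1, 2 ^ Suc k - 1}" for x
  proof -
    define N :: nat where "N = 2 ^ k"
    have "int N = M" using Mn by (simp add: N_def)
    moreover from this have "N \<ge> 4" using M by linarith
    ultimately have N: "N \<ge> 4" "int N = M" by auto
    have "x \<in> sqrt1 (2 ^ Suc k) \<longleftrightarrow> int x < 2 * M \<and> 2 * M dvd (int x - 1) * (int x + 1)"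
    proof -
      have "2 ^ Suc k = 2 * N" "int (2 * N) = 2 * M" using N by (simp_all add: N_def)
      moreover have "x < 2 * N \<longleftrightarrow> int x < 2 * M" using N by linarith
      ultimately show ?thesis
        using cong_sq_iff_int_dvd[of x "2 * N"] by (simp only: sqrt1_def mem_Collect_eq)
    qed
    also have "\<dots> \<longleftrightarrow> int x < 2 * M \<and> int x \<in> {1, M - 1, M + 1, 2 * M - 1}"
      using key[of "int x"] by auto
    also have "\<dots> \<longleftrightarrow> x \<in> {1, N - 1, N + 1, 2 * N - 1}"
      using N by auto
    finally show ?thesis by (simp add: N_def)
  qed
  then show ?thesis by blast
qed

lemma rho_two_power: "rho (2 ^ k) = (if k = 0 then 1 else if k = 1 then 1 else if k = 2 then 2 else 4)"
proof -
  consider "k = 0" | "k = 1" | "k = 2" | j where "k = Suc j" "j \<ge> 2"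
  proof -
    have "k = 0 \<or> k = 1 \<or> k = 2 \<or> (k = Suc (k - 1) \<and> k - 1 \<ge> 2)" by linarith
    then show thesis using that by blast
  qed
  then show ?thesis
  proof cases
    case 1
    then have "sqrt1 (2 ^ k) = {0}" by (auto simp: sqrt1_def)
    then show ?thesis using 1 by simp
  next
    case 2
    have "sqrt1 (2 ^ k) = {1}" using 2 by (auto simp: sqrt1_def cong_def less_2_cases_iff)
    then show ?thesis using 2 by simp
  next
    case 3
    have "x \<in> sqrt1 4 \<longleftrightarrow> x \<in> {1, 3}" for x
    proof -
      consider "x = 0" | "x = 1" | "x = 2" | "x = 3" | "x \<ge> 4" by linarith
      then show ?thesis by cases (simp_all add: sqrt1_def cong_def)
    qed
    then have "sqrt1 4 = {1, 3}" by blast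
    then have "sqrt1 (2 ^ k) = {1, 3}" using 3 by simp
    then show ?thesis using 3 by simp
  next
    case (4 j)
    define N :: nat where "N = 2 ^ j"
    have "N \<ge> 4" using 4 power_increasing[of 2 j "2::nat"] by (simp add: N_def)
    \<comment> \<open>This form removes the truncated subtractions, so that the four roots are
      visibly distinct.\<close>
    then obtain i where "N = i + 4" by (metis le_add_diff_inverse2)
    then have "card {1, N - 1, N + 1, 2 * N - 1} = 4" by (simp add: card_insert_if)
    then show ?thesis using 4 sqrt1_two_power[of j] by (simp add: N_def)
  qed
qed

text \<open>The first three terms are \<open>1 + 1/2 + 2/4 = 2\<close>; from \<open>k = 3\<close> on
  the terms form a geometric series with sum 1.\<close>

lemma rho_two_power_sums: "(\<lambda>k. real (rho (2 ^ k)) / 2 ^ k) sums 3"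
proof -
  have "(\<lambda>k. (1/2) * (1/2::real) ^ k) sums ((1/2) * (1 / (1 - 1/2)))"
    by (intro sums_mult geometric_sums) simp
  moreover have "real (rho (2 ^ (k + 3))) / 2 ^ (k + 3) = (1/2) * (1/2) ^ k" for k
    unfolding rho_two_power by (simp add: power_add power_divide)
  ultimately have "(\<lambda>k. real (rho (2 ^ (k + 3))) / 2 ^ (k + 3)) sums 1"
    by (simp only:) simp
  then have "(\<lambda>k. real (rho (2 ^ k)) / 2 ^ k) sums (1 + (\<Sum>i<3. real (rho (2 ^ i)) / 2 ^ i))"
    by (subst (asm) sums_iff_shift) simp
  moreover have "(\<Sum>i<3. real (rho (2 ^ i)) / 2 ^ i) = 2"
    by (simp add: rho_two_power numeral_3_eq_3)
  ultimately show ?thesis by simp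
qed

section \<open>The sum of \<open>rho d / d\<close>\<close>

definition rho_sum :: "nat \<Rightarrow> real" where
  "rho_sum n = (\<Sum>d=1..n. real (rho d) / real d)"

text \<open>Pairs are grouped by their product \<open>m\<close>: by \<open>rho_odd\<close> there are
  \<open>rho m\<close> of them, each of weight \<open>1 / m\<close>.\<close>

lemma coprime_pair_sum_eq:
  "coprime_pair_sum n = (\<Sum>m | m \<in> {1..n} \<and> odd m. real (rho m) / real m)"
proof -
  let ?S = "{(a, b). 0 < a \<and> 0 < b \<and> a * b \<le> n \<and> odd a \<and> odd b \<and> coprime a b}"
  have "coprime_pair_sum n = (\<Sum>m | m \<in> {1..n} \<and> odd m.
      \<Sum>p | p \<in> ?S \<and> (case p of (a, b) \<Rightarrow> a * b) = m. case p of (a, b) \<Rightarrow> 1 / (real a * real b))"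
    unfolding pair_sum_def by (rule sum.group[symmetric]) (auto simp: Suc_le_eq)
  also have "\<dots> = (\<Sum>m | m \<in> {1..n} \<and> odd m. real (rho m) / real m)"
  proof (intro sum.cong refl)
    fix m assume m: "m \<in> {m \<in> {1..n}. odd m}"
    have S: "{p. p \<in> ?S \<and> (case p of (a, b) \<Rightarrow> a * b) = m} = {(a, b). a * b = m \<and> coprime a b}"
      using m by (auto intro!: Nat.gr0I)
    have "(\<Sum>p\<in>{(a, b). a * b = m \<and> coprime a b}. case p of (a, b) \<Rightarrow> 1 / (real a * real b))
      = (\<Sum>p\<in>{(a, b). a * b = m \<and> coprime a b}. 1 / real m)"
      by (rule sum.cong) auto
    then show "(\<Sum>p | p \<in> ?S \<and> (case p of (a, b) \<Rightarrow> a * b) = m. case p of (a, b) \<Rightarrow> 1 / (real a * real b))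
      = real (rho m) / real m"
      unfolding S using m by (simp add: rho_odd)
  qed
  finally show ?thesis .
qed

text \<open>Write \<open>d = 2 ^ k * m\<close> with \<open>m\<close> odd and use multiplicativity.
  The range \<open>k \<le> n\<close> catches every \<open>d\<close>, because
  \<open>k < 2 ^ k \<le> d\<close>.\<close>

lemma rho_sum_eq:
  "rho_sum n = (\<Sum>k\<le>n. real (rho (2 ^ k)) / 2 ^ k * coprime_pair_sum (n div 2 ^ k))"
proof -
  have "rho_sum n = (\<Sum>k\<le>n. \<Sum>d | d \<in> {1..n} \<and> multiplicity 2 d = k. real (rho d) / real d)"
    unfolding rho_sum_def
  proof (rule sum.group[symmetric])
    show "multiplicity 2 ` {1..n} \<subseteq> {..n}"
    proof (rule image_subsetI)
      fix d assume d: "d \<in> {1..n}"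
      have "2 ^ multiplicity 2 d dvd d" by (rule multiplicity_dvd)
      then have "2 ^ multiplicity 2 d \<le> d" using d by (intro dvd_imp_le) auto
      moreover have "multiplicity 2 d < 2 ^ multiplicity 2 d" by (rule less_exp)
      moreover have "d \<le> n" using d by simp
      ultimately show "multiplicity 2 d \<in> {..n}" unfolding atMost_iff by linarith
    qed
  qed auto
  also have "\<dots> = (\<Sum>k\<le>n. real (rho (2 ^ k)) / 2 ^ k * coprime_pair_sum (n div 2 ^ k))"
  proof (intro sum.cong refl)
    fix k
    have "(\<Sum>d | d \<in> {1..n} \<and> multiplicity 2 d = k. real (rho d) / real d)
      = (\<Sum>m | m \<in> {1..n div 2 ^ k} \<and> odd m. real (rho (2 ^ k * m)) / real (2 ^ k * m))"
    proof (rule sum.reindex_bij_witness[where i = "\<lambda>m. 2 ^ k * m" and j = "\<lambda>d. d div 2 ^ k"])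
      fix d assume d: "d \<in> {d \<in> {1..n}. multiplicity 2 d = k}"
      then have dv: "2 ^ k dvd d" using multiplicity_dvd by auto
      then show e: "2 ^ k * (d div 2 ^ k) = d" by simp
      have "odd (d div 2 ^ k)" using d multiplicity_decompose[of d 2] by auto
      moreover have "d div 2 ^ k \<noteq> 0" using e d by (metis atLeastAtMost_iff mem_Collect_eq mult_0_right not_one_le_zero)
      ultimately show "d div 2 ^ k \<in> {m \<in> {1..n div 2 ^ k}. odd m}"
        using d by (auto simp: div_le_mono)
      show "real (rho (2 ^ k * (d div 2 ^ k))) / real (2 ^ k * (d div 2 ^ k)) = real (rho d) / real d"
        by (simp only: e)
    next
      fix m assume m: "m \<in> {m \<in> {1..n div 2 ^ k}. odd m}"
      then have "multiplicity 2 (2 ^ k * m) = k"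
        by (intro multiplicity_eqI) auto
      then show "2 ^ k * m \<in> {d \<in> {1..n}. multiplicity 2 d = k}"
        using m by (auto simp: less_eq_div_iff_mult_less_eq mult.commute)
    qed auto
    also have "\<dots> = (\<Sum>m | m \<in> {1..n div 2 ^ k} \<and> odd m. real (rho (2 ^ k)) / 2 ^ k * (real (rho m) / real m))"
    proof (intro sum.cong refl)
      fix m assume "m \<in> {m \<in> {1..n div 2 ^ k}. odd m}"
      then have "rho (2 ^ k * m) = rho (2 ^ k) * rho m" by (intro rho_mult_coprime) auto
      then show "real (rho (2 ^ k * m)) / real (2 ^ k * m) = real (rho (2 ^ k)) / 2 ^ k * (real (rho m) / real m)"
        by simp
    qed
    finally show "(\<Sum>d | d \<in> {1..n} \<and> multiplicity 2 d = k. real (rho d) / real d)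
      = real (rho (2 ^ k)) / 2 ^ k * coprime_pair_sum (n div 2 ^ k)"
      by (simp add: coprime_pair_sum_eq sum_distrib_left)
  qed
  finally show ?thesis .
qed

lemma ln_sq_coeff_rho_sum: "ln_sq_coeff rho_sum (3 / pi\<^sup>2)"
proof -
  have "ln_sq_coeff rho_sum (1 / pi\<^sup>2 * 3)"
    by (rule ln_sq_coeff_weighted_sum[OF ln_sq_coeff_coprime_pair_sum mono_pair_sum pair_sum_nonneg
          _ _ rho_two_power_sums rho_sum_eq]) auto
  then show ?thesis by simp
qed

subsection \<open>The divisor sum\<close>

text \<open>The interval splits into complete residue systems modulo \<open>d\<close>, each with
  \<open>rho d\<close> roots. For \<open>v < u\<close> it is empty, in agreement with truncated
  subtraction.\<close>

lemma card_sq_cong_blocks: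
  assumes d: "d > 0"
  shows "card {x \<in> {d * u..<d * v}. [x\<^sup>2 = 1] (mod d)} = (v - u) * rho d"
proof -
  have "bij_betw (\<lambda>x. (x div d, x mod d)) {x \<in> {d * u..<d * v}. [x\<^sup>2 = 1] (mod d)} ({u..<v} \<times> sqrt1 d)"
  proof (rule bij_betwI[where g = "\<lambda>(i, r). d * i + r"])
    show "(\<lambda>x. (x div d, x mod d)) \<in> {x \<in> {d * u..<d * v}. [x\<^sup>2 = 1] (mod d)} \<rightarrow> {u..<v} \<times> sqrt1 d"
      using d by (auto simp: sqrt1_def cong_def power_mod less_eq_div_iff_mult_less_eq
          div_less_iff_less_mult mult.commute)
    show "(\<lambda>(i, r). d * i + r) \<in> {u..<v} \<times> sqrt1 d \<rightarrow> {x \<in> {d * u..<d * v}. [x\<^sup>2 = 1] (mod d)}"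
    proof (clarsimp simp: sqrt1_def)
      fix i r assume h: "u \<le> i" "i < v" "r < d" "[r\<^sup>2 = Suc 0] (mod d)"
      have "d * u \<le> d * i" "d * Suc i \<le> d * v" using h by (intro mult_le_mono2; simp)+
      moreover have "[(d * i + r)\<^sup>2 = r\<^sup>2] (mod d)"
        by (intro cong_pow) (simp add: cong_def)
      ultimately show "d * u \<le> d * i + r \<and> d * i + r < d * v \<and> [(d * i + r)\<^sup>2 = Suc 0] (mod d)"
        using h by (auto intro: cong_trans trans_le_add1)
    qed
  qed (use d in \<open>auto simp: sqrt1_def\<close>)
  then have "card {x \<in> {d * u..<d * v}. [x\<^sup>2 = 1] (mod d)} = card ({u..<v} \<times> sqrt1 d)"
    by (rule bij_betw_same_card)
  then show ?thesis by (simp add: card_cartesian_product)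
qed

text \<open>The interval is enclosed between unions of complete blocks. The upper bound completes
  the last block; the lower bound keeps the blocks from \<open>2 * d\<close> up to
  \<open>d * (N div d)\<close>.\<close>

lemma card_sq_cong_bounds:
  fixes d N :: nat
  assumes d: "d > 0"
  defines "C \<equiv> real (card {x \<in> {d<..N}. [x\<^sup>2 = 1] (mod d)})"
  shows "C \<le> real N / real d * real (rho d)" and "(real N / real d - 3) * real (rho d) \<le> C"
proof -
  have "N < d * (N div d + 1)" using d dividend_less_times_div[of d N] by simp
  then have "card {x \<in> {d<..N}. [x\<^sup>2 = 1] (mod d)} \<le> card {x \<in> {d * 1..<d * (N div d + 1)}. [x\<^sup>2 = 1] (mod d)}"
    by (intro card_mono) auto
  also have "\<dots> = (N div d) * rho d" by (simp only: card_sq_cong_blocks[OF d] diff_add_inverse2)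
  finally have "C \<le> real (N div d) * real (rho d)"
    unfolding C_def by (metis of_nat_le_iff of_nat_mult)
  also have "\<dots> \<le> real N / real d * real (rho d)"
    by (intro mult_right_mono of_nat_div_le_of_nat) auto
  finally show "C \<le> real N / real d * real (rho d)" .
  have "real N < real d * (real (N div d) + 1)"
    using \<open>N < d * (N div d + 1)\<close> by (metis of_nat_1 of_nat_add of_nat_less_iff of_nat_mult)
  then have "real N / real d - 1 \<le> real (N div d)" using d by (simp add: field_simps)
  \<comment> \<open>The constant 3 is 1 for rounding \<open>N / d\<close> down plus 2 for the blocks
    below \<open>2 * d\<close>.\<close>
  then have "real N / real d - 3 \<le> real (N div d - 2)" by linarith
  then have "(real N / real d - 3) * real (rho d) \<le> real ((N div d - 2) * rho d)"
    by (simp add: mult_right_mono)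
  also have "(N div d - 2) * rho d = card {x \<in> {d * 2..<d * (N div d)}. [x\<^sup>2 = 1] (mod d)}"
    by (simp only: card_sq_cong_blocks[OF d])
  also have "real \<dots> \<le> C"
  proof -
    have "d * (N div d) \<le> N" by simp
    then have "{x \<in> {d * 2..<d * (N div d)}. [x\<^sup>2 = 1] (mod d)} \<subseteq> {x \<in> {d<..N}. [x\<^sup>2 = 1] (mod d)}"
      using d by (auto intro: less_imp_le[OF order_less_le_trans])
    then show ?thesis unfolding C_def of_nat_le_iff by (intro card_mono) auto
  qed
  finally show "(real N / real d - 3) * real (rho d) \<le> C" .
qed

text \<open>The involution \<open>k \<mapsto> (n\<^sup>2 - 1) div k\<close> exchanges the divisors \<open>< n\<close> and \<open>\<ge> n\<close>: two factors
  below \<open>n\<close> have a product at most \<open>(n - 1)\<^sup>2 < n\<^sup>2 - 1\<close>, two others at least \<open>n\<^sup>2\<close>.\<close>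

lemma num_divisors_sq_minus_one:
  assumes n: "n \<ge> 2"
  shows "num_divisors (n\<^sup>2 - 1) = 2 * card {d \<in> {1..<n}. [n\<^sup>2 = 1] (mod d)}"
proof -
  define m where "m = n\<^sup>2 - 1"
  have "2 * 2 \<le> n * n" using n by (intro mult_le_mono)
  then have m: "m + 1 = n * n" "m > 0" by (auto simp: m_def power2_eq_square)
  have lo: "k * l \<noteq> m" if "k \<ge> n" "l \<ge> n" for k l
    using mult_le_mono[OF that] m by auto
  have hi: "k * l \<noteq> m" if "k < n" "l < n" for k l
  proof -
    have "k \<le> n - 1" "l \<le> n - 1" using that by auto
    then have "k * l \<le> (n - 1) * (n - 1)" by (rule mult_le_mono)
    also have "\<dots> < m"
    proof -
      obtain j where "n = Suc (Suc j)" using n by (metis add_2_eq_Suc le_Suc_ex)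
      then show ?thesis by (simp add: m_def power2_eq_square)
    qed
    finally show ?thesis by simp
  qed
  let ?L = "{k. k dvd m \<and> k < n}" and ?U = "{k. k dvd m \<and> \<not> k < n}"
  have fin: "finite ?L" "finite ?U" using m(2) by auto
  have "bij_betw (\<lambda>k. m div k) ?L ?U"
  proof (rule bij_betwI[where g = "\<lambda>k. m div k"])
    show "(div) m \<in> ?L \<rightarrow> ?U"
    proof (intro Pi_I)
      fix k assume k: "k \<in> ?L"
      then have "k * (m div k) = m" by simp
      then show "m div k \<in> ?U" using k hi[of k "m div k"] by (auto simp: div_dvd_iff_mult)
    qed
    show "(div) m \<in> ?U \<rightarrow> ?L"
    proof (intro Pi_I)
      fix k assume k: "k \<in> ?U"
      then have "k * (m div k) = m" by simp
      then have "m div k dvd m" "\<not> n \<le> m div k"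
        using k lo[of k "m div k"] by (metis dvd_triv_right, auto)
      then show "m div k \<in> ?L" by simp
    qed
  qed (use m(2) in auto)
  then have "card ?L = card ?U" by (rule bij_betw_same_card)
  moreover have "card {k. k dvd m} = card (?L \<union> ?U)" by (rule arg_cong[of _ _ card]) auto
  moreover have "card (?L \<union> ?U) = card ?L + card ?U" by (rule card_Un_disjoint[OF fin]) auto
  ultimately have "num_divisors m = 2 * card ?L"
    unfolding num_divisors_def by linarith
  moreover have "?L = {d \<in> {1..<n}. [n\<^sup>2 = 1] (mod d)}"
  proof -
    have "k dvd m \<longleftrightarrow> [n\<^sup>2 = 1] (mod k)" for k
    proof -
      have "n\<^sup>2 \<ge> 1" using n by simp
      then have "[n\<^sup>2 = 1] (mod k) \<longleftrightarrow> k dvd n\<^sup>2 - 1"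
        by (rule cong_altdef_nat)
      then show ?thesis by (simp add: m_def)
    qed
    moreover have "k dvd m \<Longrightarrow> 1 \<le> k" for k using m(2) by (cases k) auto
    ultimately show ?thesis by auto
  qed
  ultimately show ?thesis by (simp add: m_def)
qed

text \<open>The order of summation is exchanged; \<open>n \<ge> 2\<close> is implied by
  \<open>1 \<le> d < n\<close>.\<close>

lemma sum_num_divisors_eq:
  "(\<Sum>n=2..N. real (num_divisors (n\<^sup>2 - 1))) = 2 * (\<Sum>d=1..N. real (card {n \<in> {d<..N}. [n\<^sup>2 = 1] (mod d)}))"
proof -
  have "(\<Sum>n=2..N. real (num_divisors (n\<^sup>2 - 1))) = (\<Sum>n=2..N. 2 * (\<Sum>d | d \<in> {1..<n} \<and> [n\<^sup>2 = 1] (mod d). 1))"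
    using num_divisors_sq_minus_one by (intro sum.cong refl) simp
  also have "\<dots> = 2 * (\<Sum>n=2..N. \<Sum>d | d \<in> {1..<n} \<and> [n\<^sup>2 = 1] (mod d). 1)"
    by (simp only: sum_distrib_left)
  also have "(\<Sum>n=2..N. \<Sum>d | d \<in> {1..<n} \<and> [n\<^sup>2 = 1] (mod d). (1::real))
    = (\<Sum>n=2..N. \<Sum>d | d \<in> {1..N} \<and> d < n \<and> [n\<^sup>2 = 1] (mod d). 1)"
    by (intro sum.cong refl) auto
  also have "\<dots> = (\<Sum>d=1..N. \<Sum>n | n \<in> {2..N} \<and> d < n \<and> [n\<^sup>2 = 1] (mod d). 1)"
    by (rule sum.swap_restrict) auto
  also have "\<dots> = (\<Sum>d=1..N. real (card {n \<in> {d<..N}. [n\<^sup>2 = 1] (mod d)}))"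
  proof (intro sum.cong refl)
    fix d assume "d \<in> {1..N}"
    then have "{n. n \<in> {2..N} \<and> d < n \<and> [n\<^sup>2 = 1] (mod d)} = {n \<in> {d<..N}. [n\<^sup>2 = 1] (mod d)}"
      by auto
    then show "(\<Sum>n | n \<in> {2..N} \<and> d < n \<and> [n\<^sup>2 = 1] (mod d). 1) = real (card {n \<in> {d<..N}. [n\<^sup>2 = 1] (mod d)})"
      by simp
  qed
  finally show ?thesis .
qed

lemma sum_num_divisors_upper:
  "(\<Sum>n=2..N. real (num_divisors (n\<^sup>2 - 1))) \<le> 2 * real N * rho_sum N"
proof -
  have "(\<Sum>d=1..N. real (card {n \<in> {d<..N}. [n\<^sup>2 = 1] (mod d)}))
      \<le> (\<Sum>d=1..N. real N / real d * real (rho d))"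
    by (intro sum_mono card_sq_cong_bounds) auto
  also have "\<dots> = real N * rho_sum N"
    by (simp add: rho_sum_def sum_distrib_left)
  finally show ?thesis unfolding sum_num_divisors_eq by simp
qed

text \<open>Moduli above \<open>N div K\<close> are dropped. For the others
  \<open>K \<le> N / d\<close>, so the loss of 3 blocks is at most the fraction \<open>3 / K\<close>
  of \<open>N / d\<close>.\<close>

lemma sum_num_divisors_lower:
  assumes K: "K > 0"
  shows "2 * real N * (1 - 3 / real K) * rho_sum (N div K) \<le> (\<Sum>n=2..N. real (num_divisors (n\<^sup>2 - 1)))"
proof -
  have "real N * (1 - 3 / real K) * rho_sum (N div K)
    = (\<Sum>d=1..N div K. real N / real d * (1 - 3 / real K) * real (rho d))"
    by (simp add: rho_sum_def sum_distrib_left mult_ac)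
  also have "\<dots> \<le> (\<Sum>d=1..N div K. real (card {n \<in> {d<..N}. [n\<^sup>2 = 1] (mod d)}))"
  proof (rule sum_mono)
    fix d assume d: "d \<in> {1..N div K}"
    then have "d * K \<le> N" using K by (simp add: less_eq_div_iff_mult_less_eq)
    then have "real d * real K \<le> real N" by (metis of_nat_le_iff of_nat_mult)
    then have "1 \<le> real N / real d / real K" using d K by (simp add: field_simps)
    moreover have "real N / real d * (1 - 3 / real K) = real N / real d - 3 * (real N / real d / real K)"
      by (simp add: algebra_simps)
    ultimately have "real N / real d * (1 - 3 / real K) \<le> real N / real d - 3" by linarith
    then have "real N / real d * (1 - 3 / real K) * real (rho d) \<le> (real N / real d - 3) * real (rho d)"
      by (rule mult_right_mono) simp
    also have "\<dots> \<le> real (card {n \<in> {d<..N}. [n\<^sup>2 = 1] (mod d)})"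
      using d by (intro card_sq_cong_bounds) auto
    finally show "real N / real d * (1 - 3 / real K) * real (rho d)
      \<le> real (card {n \<in> {d<..N}. [n\<^sup>2 = 1] (mod d)})" .
  qed
  also have "\<dots> \<le> (\<Sum>d=1..N. real (card {n \<in> {d<..N}. [n\<^sup>2 = 1] (mod d)}))"
    by (intro sum_mono2) (auto intro: order_trans[OF _ div_le_dividend])
  finally show ?thesis unfolding sum_num_divisors_eq by simp
qed

theorem theorem1:
  shows "(\<lambda>N::nat. \<Sum>n=2..N. real (num_divisors (n ^ 2 - 1)))
           \<sim>[at_top] (\<lambda>N. 6 / pi ^ 2 * real N * (ln (real N)) ^ 2)"
proof -
  define S where "S N = (\<Sum>n=2..N. real (num_divisors (n\<^sup>2 - 1)))" for N :: nat
  have "(\<lambda>N. S N / real N / (ln (real N))\<^sup>2) \<longlonglongrightarrow> 6 / pi\<^sup>2"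
  proof (rule order_tendstoI)
    fix a assume "6 / pi\<^sup>2 < a"
    moreover have "(\<lambda>N. 2 * (rho_sum N / (ln (real N))\<^sup>2)) \<longlonglongrightarrow> 2 * (3 / pi\<^sup>2)"
      using ln_sq_coeff_rho_sum unfolding ln_sq_coeff_def by (rule tendsto_mult_left)
    ultimately have "\<forall>\<^sub>F N in sequentially. 2 * (rho_sum N / (ln (real N))\<^sup>2) < a"
      by (intro order_tendstoD) auto
    then show "\<forall>\<^sub>F N in sequentially. S N / real N / (ln (real N))\<^sup>2 < a"
      using eventually_gt_at_top[of 0]
    proof eventually_elim
      case (elim N)
      have "S N / real N \<le> 2 * rho_sum N"
        using sum_num_divisors_upper[of N] elim by (simp add: S_def field_simps)
      then have "S N / real N / (ln (real N))\<^sup>2 \<le> 2 * rho_sum N / (ln (real N))\<^sup>2"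
        by (intro divide_right_mono) auto
      then show ?case using elim by simp
    qed
  next
    fix a assume "a < 6 / pi\<^sup>2"
    moreover have "(\<lambda>K. 2 * (1 - 3 / real K) * (3 / pi\<^sup>2)) \<longlonglongrightarrow> 2 * (1 - 0) * (3 / pi\<^sup>2)"
      by (intro tendsto_intros lim_const_over_n)
    ultimately have "\<forall>\<^sub>F K in sequentially. a < 2 * (1 - 3 / real K) * (3 / pi\<^sup>2)"
      by (intro order_tendstoD) auto
    then have "\<forall>\<^sub>F K in sequentially. a < 2 * (1 - 3 / real K) * (3 / pi\<^sup>2) \<and> K > 0"
      using eventually_gt_at_top[of 0] by eventually_elim simp
    \<comment> \<open>\<open>K\<close> is fixed before \<open>N\<close> tends to infinity: it brings
      \<open>1 - 3 / K\<close> close enough to 1, while replacing \<open>N\<close> by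
      \<open>N div K\<close> leaves the coefficient of \<open>rho_sum\<close> unchanged.\<close>
    then obtain K where K: "a < 2 * (1 - 3 / real K) * (3 / pi\<^sup>2)" "K > 0"
      using eventually_happens'[OF sequentially_bot] by blast
    have "(\<lambda>N. 2 * (1 - 3 / real K) * (rho_sum (N div K) / (ln (real N))\<^sup>2)) \<longlonglongrightarrow> 2 * (1 - 3 / real K) * (3 / pi\<^sup>2)"
      using ln_sq_coeff_div_arg[OF ln_sq_coeff_rho_sum K(2)] unfolding ln_sq_coeff_def
      by (rule tendsto_mult_left)
    then have "\<forall>\<^sub>F N in sequentially. a < 2 * (1 - 3 / real K) * (rho_sum (N div K) / (ln (real N))\<^sup>2)"
      using K by (intro order_tendstoD)
    then show "\<forall>\<^sub>F N in sequentially. a < S N / real N / (ln (real N))\<^sup>2"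
      using eventually_gt_at_top[of 0]
    proof eventually_elim
      case (elim N)
      have "real N * (2 * (1 - 3 / real K) * rho_sum (N div K)) \<le> S N"
        using sum_num_divisors_lower[OF K(2), of N] by (simp add: S_def mult_ac)
      then have "2 * (1 - 3 / real K) * rho_sum (N div K) \<le> S N / real N"
        using elim by (simp add: pos_le_divide_eq mult.commute)
      then have "2 * (1 - 3 / real K) * rho_sum (N div K) / (ln (real N))\<^sup>2 \<le> S N / real N / (ln (real N))\<^sup>2"
        by (intro divide_right_mono) auto
      then show ?case using elim by simp
    qed
  qed
  then have "(\<lambda>N. S N / real N / (ln (real N))\<^sup>2 / (6 / pi\<^sup>2)) \<longlonglongrightarrow> (6 / pi\<^sup>2) / (6 / pi\<^sup>2)"
    by (rule tendsto_divide) auto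
  then have "(\<lambda>N. S N / (6 / pi\<^sup>2 * real N * (ln (real N))\<^sup>2)) \<longlonglongrightarrow> 1"
    by (simp add: divide_divide_eq_left divide_divide_eq_right mult_ac)
  then show ?thesis
    unfolding S_def by (rule asymp_equivI')
qed

end
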